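(* Let $S$ be a monoid. All subacts of indecomposable right $S$-acts are indecomposable if and only if $S$ is left reversible.
   Context: A right $S$-act over a monoid $S$ is a nonempty set $A$ with a map $A\times S\to A$, $(a,s)\mapsto as$, such that $a(st)=(as)t$ and $a1=a$ for all $a\in A$, $s,t\in S$. A subact is a nonempty subset closed under the action. A right $S$-act $A$ is decomposable if there are subacts $B,C\subseteq A$ (both nonempty) with $A=B\cup C$ and $B\cap C=\emptyset$; otherwise it is indecomposable. A monoid $S$ is left reversible if any two (nonempty) right ideals of $S$ have nonempty intersection. *)

theory Defs
  imports "HOL-Algebra.Group" "HOL-Library.Equipollence"
begin

locale right_act = monoid S for S (structure) +
  fixes A :: "'b set" and act :: "'b \<Rightarrow> 'a \<Rightarrow> 'b"
  assumes nonempty: "A \<noteq> {}"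
    and act_closed: "\<lbrakk>a \<in> A; s \<in> carrier S\<rbrakk> \<Longrightarrow> act a s \<in> A"
    and act_mult: "\<lbrakk>a \<in> A; s \<in> carrier S; t \<in> carrier S\<rbrakk> \<Longrightarrow> act a (s \<otimes> t) = act (act a s) t"
    and act_one: "a \<in> A \<Longrightarrow> act a \<one> = a"

definition subact :: "('a, 'm) monoid_scheme \<Rightarrow> 'b set \<Rightarrow> ('b \<Rightarrow> 'a \<Rightarrow> 'b) \<Rightarrow> 'b set \<Rightarrow> bool" where
  "subact S A act B \<longleftrightarrow> B \<noteq> {} \<and> B \<subseteq> A \<and> (\<forall>b\<in>B. \<forall>s\<in>carrier S. act b s \<in> B)"

text \<open>A subact is regarded as an act in its own right with the same map \<open>act\<close>, of which
  only the values on the subact matter.\<close>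

lemma (in right_act) right_act_subact:
  assumes "subact S A act B"
  shows "right_act S B act"
  using assms act_mult act_one
  unfolding subact_def by unfold_locales auto

definition decomposable :: "('a, 'm) monoid_scheme \<Rightarrow> 'b set \<Rightarrow> ('b \<Rightarrow> 'a \<Rightarrow> 'b) \<Rightarrow> bool" where
  "decomposable S A act \<longleftrightarrow>
     (\<exists>B C. subact S A act B \<and> subact S A act C \<and> A = B \<union> C \<and> B \<inter> C = {})"

abbreviation indecomposable :: "('a, 'm) monoid_scheme \<Rightarrow> 'b set \<Rightarrow> ('b \<Rightarrow> 'a \<Rightarrow> 'b) \<Rightarrow> bool" where
  "indecomposable S A act \<equiv> \<not> decomposable S A act"

definition right_ideal :: "('a, 'm) monoid_scheme \<Rightarrow> 'a set \<Rightarrow> bool" where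
  "right_ideal S I \<longleftrightarrow>
     I \<noteq> {} \<and> I \<subseteq> carrier S \<and> (\<forall>x\<in>I. \<forall>s\<in>carrier S. x \<otimes>\<^bsub>S\<^esub> s \<in> I)"

definition left_reversible :: "('a, 'm) monoid_scheme \<Rightarrow> bool" where
  "left_reversible S \<longleftrightarrow> (\<forall>I J. right_ideal S I \<and> right_ideal S J \<longrightarrow> I \<inter> J \<noteq> {})"

text \<open>HOL cannot quantify over types inside a formula, so the type in which the underlying sets
  of the acts live is a parameter.  The property is only meaningful as a hypothesis when that type
  is large enough to hold a copy of \<open>S\<close>: over a one-element type it holds for every monoid.\<close>

definition indecomposable_subacts :: "'b itself \<Rightarrow> ('a, 'm) monoid_scheme \<Rightarrow> bool" where
  "indecomposable_subacts _ S \<longleftrightarrow>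
     (\<forall>(A :: 'b set) act B.
        right_act S A act \<and> indecomposable S A act \<and> subact S A act B
          \<longrightarrow> indecomposable S B act)"

end

theory Submission
  imports Defs
begin

text \<open>If \<open>B\<close> splits as a disjoint union of subacts \<open>C\<close> and \<open>D\<close>, then over a left reversible monoid
  the elements of \<open>A\<close> having some multiple in \<open>C\<close> form a subact, and so do the remaining ones, which
  include \<open>D\<close>; hence \<open>A\<close> splits too. Conversely, two disjoint right ideals form a decomposable
  subact of \<open>S\<close> acting on itself, which is cyclic and therefore indecomposable.\<close>

text \<open>Left reversibility is applied to the principal right ideals generated by
  \<open>s\<close> and \<open>t\<close>: any element of their intersection is a common right
  multiple.\<close>

lemma (in monoid) left_reversible_common_multiple:
  assumes "left_reversible G" and s: "s \<in> carrier G" and t: "t \<in> carrier G"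
  obtains x y where "x \<in> carrier G" "y \<in> carrier G" "s \<otimes> x = t \<otimes> y"
proof -
  have principal: "right_ideal G ((\<otimes>) u ` carrier G)" if "u \<in> carrier G" for u
    using that by (auto simp: right_ideal_def m_assoc)
  have "(\<otimes>) s ` carrier G \<inter> (\<otimes>) t ` carrier G \<noteq> {}"
    using assms principal by (simp add: left_reversible_def)
  then show thesis
    using that by auto
qed

lemma (in right_act) decomposable_if_decomposable_subact:
  assumes rev: "left_reversible S" and B: "subact S A act B" and dec: "decomposable S B act"
  shows "decomposable S A act"
proof -
  obtain C D where C: "subact S B act C" and D: "subact S B act D" and disj: "C \<inter> D = {}"
    using dec by (auto simp: decomposable_def)
  define E where "E = {a \<in> A. \<exists>s\<in>carrier S. act a s \<in> C}"
  have "C \<subseteq> A" "D \<subseteq> A"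
    using B C D by (auto simp: subact_def)
  have "C \<subseteq> E"
    using \<open>C \<subseteq> A\<close> act_one by (force simp: E_def)
  \<comment> \<open>Multiples of elements of \<open>D\<close> stay in \<open>D\<close> and so miss
    \<open>C\<close>. This also makes \<open>A - E\<close> nonempty.\<close>
  have "D \<subseteq> A - E"
    using \<open>D \<subseteq> A\<close> D disj by (auto simp: E_def subact_def)
  have "act a r \<in> E" if a: "a \<in> E" and r: "r \<in> carrier S" for a r
  proof -
    obtain s where s: "s \<in> carrier S" "act a s \<in> C" and "a \<in> A"
      using a by (auto simp: E_def)
    \<comment> \<open>Left reversibility enters here: multiplying by \<open>x\<close> turns the
      multiple by \<open>r\<close> into a further multiple of \<open>act a s\<close>, which lies in
      \<open>C\<close>.\<close>
    obtain x y where xy: "x \<in> carrier S" "y \<in> carrier S" "r \<otimes> x = s \<otimes> y"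
      using left_reversible_common_multiple[OF rev r s(1)] .
    have "act (act a r) x = act (act a s) y"
      using act_mult \<open>a \<in> A\<close> r s(1) xy by metis
    also have "\<dots> \<in> C"
      using C s(2) xy(2) by (simp add: subact_def)
    finally show ?thesis
      using \<open>a \<in> A\<close> r xy(1) act_closed by (auto simp: E_def)
  qed
  then have "subact S A act E"
    using C \<open>C \<subseteq> E\<close> by (auto simp: subact_def E_def)
  \<comment> \<open>A multiple of \<open>act a r\<close> is a multiple of \<open>a\<close>, so if it
    lay in \<open>C\<close>, then \<open>a\<close> would be in \<open>E\<close>.\<close>
  moreover have "act a r \<in> A - E" if "a \<in> A - E" "r \<in> carrier S" for a r
    using that by (auto simp: E_def act_closed simp flip: act_mult)
  then have "subact S A act (A - E)"
    using D \<open>D \<subseteq> A - E\<close> by (auto simp: subact_def)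
  moreover have "A = E \<union> (A - E)" "E \<inter> (A - E) = {}"
    by (auto simp: E_def)
  ultimately show ?thesis
    unfolding decomposable_def by blast
qed

text \<open>A subact containing the generator \<open>a\<close> is all of \<open>A\<close>, which
  leaves nothing for a disjoint second part.\<close>

lemma cyclic_indecomposable:
  assumes "a \<in> A" and gen: "\<And>b. b \<in> A \<Longrightarrow> \<exists>s\<in>carrier S. b = act a s"
  shows "indecomposable S A act"
proof -
  have "A \<subseteq> C" if "subact S A act C" "a \<in> C" for C
  proof
    fix b
    assume "b \<in> A"
    then obtain s where "s \<in> carrier S" "b = act a s"
      using gen by blast
    then show "b \<in> C"
      using that by (simp add: subact_def)
  qed
  then show ?thesis
    using \<open>a \<in> A\<close> unfolding decomposable_def subact_def by blast
qed

lemma (in monoid) left_reversible_if_indecomposable_subacts: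
  assumes le: "carrier G \<lesssim> (UNIV :: 'c set)" and ind: "indecomposable_subacts TYPE('c) G"
  shows "left_reversible G"
  unfolding left_reversible_def
proof (intro allI impI notI, elim conjE)
  fix I J
  assume I: "right_ideal G I" and J: "right_ideal G J" and disj: "I \<inter> J = {}"
  obtain g :: "'a \<Rightarrow> 'c" where g: "inj_on g (carrier G)"
    using le by (auto simp: lepoll_def)
  \<comment> \<open>Right multiplication of the monoid on itself, transported along \<open>g\<close>
    so that the act lives in \<open>'c\<close>. Values off the image of \<open>g\<close> do not
    matter.\<close>
  define act where "act b s = g (inv_into (carrier G) g b \<otimes> s)" for b s
  have act_g [simp]: "act (g x) s = g (x \<otimes> s)" if "x \<in> carrier G" for x s
    using that g by (simp add: act_def)
  have act: "right_act G (g ` carrier G) act"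
    by unfold_locales (auto simp: m_assoc)
  have indec: "indecomposable G (g ` carrier G) act"
    by (rule cyclic_indecomposable[of "g \<one>"]) auto
  \<comment> \<open>The ambient set \<open>X\<close> is left open: it will be the whole image of the
    monoid, and then the image of \<open>I \<union> J\<close>.\<close>
  have ideal: "subact G X act (g ` K)" if "right_ideal G K" "g ` K \<subseteq> X" for K X
  proof -
    have "K \<subseteq> carrier G"
      using that by (simp add: right_ideal_def)
    then show ?thesis
      using that by (auto simp: right_ideal_def subact_def subset_iff)
  qed
  have sub: "I \<subseteq> carrier G" "J \<subseteq> carrier G"
    using I J by (auto simp: right_ideal_def)
  have "right_ideal G (I \<union> J)"
    using I J by (auto simp: right_ideal_def)
  then have "subact G (g ` carrier G) act (g ` (I \<union> J))"
    using sub by (intro ideal) auto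
  then have "indecomposable G (g ` (I \<union> J)) act"
    using ind act indec by (auto simp: indecomposable_subacts_def)
  \<comment> \<open>Injectivity of \<open>g\<close> keeps the images disjoint.\<close>
  moreover have "g ` I \<inter> g ` J = {}"
    using inj_on_image_Int[OF g sub] disj by simp
  then have "decomposable G (g ` (I \<union> J)) act"
    unfolding decomposable_def
    by (intro exI[of _ "g ` I"] exI[of _ "g ` J"]) (simp add: I J ideal image_Un)
  ultimately show False
    by contradiction
qed

theorem proposition2p3:
  fixes S :: "('a, 'm) monoid_scheme"
  assumes "monoid S"
  shows "(carrier S \<lesssim> (UNIV :: 'b set) \<longrightarrow>
            (indecomposable_subacts TYPE('b) S \<longleftrightarrow> left_reversible S))
       \<and> (left_reversible S \<longrightarrow> indecomposable_subacts TYPE('b) S)"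
proof -
  have "indecomposable_subacts TYPE('b) S" if "left_reversible S"
    using that right_act.decomposable_if_decomposable_subact
    unfolding indecomposable_subacts_def by blast
  then show ?thesis
    using monoid.left_reversible_if_indecomposable_subacts[OF assms] by blast
qed

end
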